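(* For all $n\ge1$, $$H_n\left(\frac{E_k(1)}{k!}\right)=\frac{(2n+2)!}{(n+1)!}\cdot H_n\left(\frac{E_{k+1}(1)}{(k+1)!}\right),$$ where $E_j(x)$ are the Euler polynomials.
   Context: For a sequence $(a_k)_{k\ge 0}$ and $n\ge 0$, $H_n(a_k):=\det(a_{i+j})_{0\le i,j\le n}$ denotes the $(n+1)\times(n+1)$ Hankel determinant; in the claim the sequences are indexed by $k\ge0$. The Euler polynomials are defined by $\frac{2e^{xt}}{e^t+1}=\sum_{n\ge0}E_n(x)\frac{t^n}{n!}$. *)

theory Defs
  imports
    "HOL-Computational_Algebra.Formal_Power_Series"
    "Jordan_Normal_Form.Determinant"
begin

(* The division is exact: the constant term of fps_exp 1 + 1 is 2, a unit. *)
definition euler_poly :: "nat \<Rightarrow> real \<Rightarrow> real" where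
  "euler_poly n x = fact n * fps_nth (2 * fps_exp x / (fps_exp 1 + 1)) n"

lemma euler_poly_gen_fun:
  "Abs_fps (\<lambda>n. euler_poly n x / fact n) * (fps_exp 1 + 1) = 2 * fps_exp x"
proof -
  have "Abs_fps (\<lambda>n. euler_poly n x / fact n) = 2 * fps_exp x / (fps_exp 1 + 1)"
    by (simp add: fps_eq_iff euler_poly_def)
  moreover have "fps_nth (fps_exp 1 + 1 :: real fps) 0 \<noteq> 0"
    by simp
  ultimately show ?thesis
    by (simp add: fps_divide_unit inverse_mult_eq_1 mult.assoc)
qed

(* euler_poly n really is a polynomial function of its second argument. *)
lemma euler_poly_is_poly: "\<exists>p. \<forall>x. euler_poly n x = poly p x"
proof -
  define c where "c = fps_nth (inverse (fps_exp 1 + 1 :: real fps))"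
  have "fps_nth (fps_exp 1 + 1 :: real fps) 0 \<noteq> 0"
    by simp
  then have "2 * fps_exp x / (fps_exp 1 + 1) = fps_const 2 * (fps_exp x * inverse (fps_exp 1 + 1))"
    for x :: real
    by (simp add: fps_divide_unit mult.assoc numeral_fps_const)
  then have "euler_poly n x = fact n * (2 * (\<Sum>i=0..n. fps_nth (fps_exp x) i * c (n - i)))" for x
    unfolding euler_poly_def c_def
    by (simp only: fps_mult_left_const_nth) (simp only: fps_mult_nth)
  then have "euler_poly n x =
      poly (\<Sum>i=0..n. monom (fact n * 2 * c (n - i) / fact i) i) x" for x
    by (simp add: poly_sum poly_monom sum_distrib_left mult_ac)
  then show ?thesis
    by blast
qed

definition hankel_det :: "nat \<Rightarrow> (nat \<Rightarrow> real) \<Rightarrow> real" where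
  "hankel_det n a = det (mat (n + 1) (n + 1) (\<lambda>(i, j). a (i + j)))"

end

theory Submission imports Defs begin

text \<open>
  Put \<open>N = n + 1\<close>. If column \<open>N\<close> of the infinite Hankel matrix, cut off after \<open>N\<close> rows, is the
  combination of the columns \<open>0, \<dots>, N - 1\<close> with coefficients \<open>c\<^sub>0, \<dots>, c\<^bsub>N-1\<^esub>\<close>, then the shifted
  Hankel matrix is the unshifted one times a companion matrix, so the two determinants differ by
  the factor \<open>(-1)^n * c\<^sub>0\<close>. Such a relation amounts to a polynomial \<open>Q\<close> of degree at most \<open>N\<close>, with
  constant term \<open>1\<close>, such that the coefficients of \<open>t^N, \<dots>, t^(2N-1)\<close> in \<open>f Q\<close> vanish, where
  \<open>f = 2 e^t / (e^t + 1)\<close>. If \<open>D\<close> is the denominator and \<open>R\<close> the numerator of the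
  \<open>[N-1/N]\<close> Pade approximant of the exponential, so that \<open>e^t D = R + O(t^(2N))\<close>, then
  \<open>Q = (D + R) / 2\<close> satisfies \<open>f Q = R + O(t^(2N))\<close>. The coefficient of \<open>t^N\<close> in \<open>Q\<close> gives the ratio.
\<close>

text \<open>An \<open>N\<close>-th finite difference kills a polynomial in \<open>k\<close> of
  degree \<open>r < N\<close>. Pascal's rule for \<open>Suc N\<close> splits off one difference;
  Pascal's rule for the other binomial then lowers \<open>r\<close> by one, and
  \<open>N \<le> M\<close> keeps \<open>M - k\<close> free of truncation.\<close>

lemma alternating_sum_binomial_choose_eq_0:
  fixes N M r :: nat
  assumes "r < N" "N \<le> M"
  shows "(\<Sum>k\<le>N. (-1) ^ k * of_nat (N choose k) * of_nat ((M - k) choose r)) = (0 :: 'a :: comm_ring_1)"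
  using assms
proof (induction N arbitrary: M r)
  case 0
  then show ?case by simp
next
  case (Suc N)
  let ?b = "\<lambda>k. of_nat ((M - k) choose r) :: 'a"
  have M: "M - k = Suc (M - 1 - k)" if "k \<le> N" for k
    using that Suc.prems by simp
  have "(\<Sum>k\<le>Suc N. (-1) ^ k * of_nat (Suc N choose k) * ?b k)
      = ?b 0 + (\<Sum>k\<le>N. (-1) ^ Suc k * of_nat (Suc N choose Suc k) * ?b (Suc k))"
    by (simp add: sum.atMost_Suc_shift del: sum.atMost_Suc binomial_Suc_Suc)
  also have "\<dots> = (?b 0 + (\<Sum>k\<le>N. (-1) ^ Suc k * of_nat (N choose Suc k) * ?b (Suc k)))
      - (\<Sum>k\<le>N. (-1) ^ k * of_nat (N choose k) * ?b (Suc k))"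
    by (simp add: algebra_simps sum.distrib sum_subtractf sum_negf)
  also have "?b 0 + (\<Sum>k\<le>N. (-1) ^ Suc k * of_nat (N choose Suc k) * ?b (Suc k))
      = (\<Sum>k\<le>Suc N. (-1) ^ k * of_nat (N choose k) * ?b k)"
    by (simp add: sum.atMost_Suc_shift del: sum.atMost_Suc)
  also have "\<dots> = (\<Sum>k\<le>N. (-1) ^ k * of_nat (N choose k) * ?b k)"
    by (simp add: binomial_eq_0)
  also have "\<dots> - (\<Sum>k\<le>N. (-1) ^ k * of_nat (N choose k) * ?b (Suc k))
      = (\<Sum>k\<le>N. (-1) ^ k * of_nat (N choose k) * (?b k - ?b (Suc k)))"
    by (simp add: right_diff_distrib sum_subtractf)
  also have "\<dots> = 0"
  proof (cases r)
    case 0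
    then show ?thesis by simp
  next
    case (Suc r')
    have "(\<Sum>k\<le>N. (-1) ^ k * of_nat (N choose k) * (?b k - ?b (Suc k)))
        = (\<Sum>k\<le>N. (-1) ^ k * of_nat (N choose k) * of_nat ((M - 1 - k) choose r'))"
      by (intro sum.cong refl) (simp add: M Suc)
    also have "\<dots> = 0"
      by (rule Suc.IH) (use Suc Suc.prems in auto)
    finally show ?thesis .
  qed
  finally show ?case .
qed

definition pade_exp_denom :: "nat \<Rightarrow> real fps" where
  "pade_exp_denom N =
     Abs_fps (\<lambda>k. (-1) ^ k * of_nat (N choose k) * fact (2 * N - 1 - k) / fact (2 * N - 1))"

lemma pade_exp_denom_nth_eq_0: "N < k \<Longrightarrow> fps_nth (pade_exp_denom N) k = 0"
  by (simp add: pade_exp_denom_def)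

lemma exp_mult_pade_exp_denom_nth_eq_0:
  assumes "N \<le> m" "m < 2 * N"
  shows "fps_nth (fps_exp 1 * pade_exp_denom N) m = 0"
proof -
  let ?r = "2 * N - 1 - m"
  have "fps_nth (fps_exp 1 * pade_exp_denom N) m
      = (\<Sum>k\<le>m. fps_nth (pade_exp_denom N) k / fact (m - k))"
    by (simp add: mult.commute[of "fps_exp 1"] fps_mult_nth atLeast0AtMost)
  also have "\<dots> = (\<Sum>k\<le>N. fps_nth (pade_exp_denom N) k / fact (m - k))"
    using assms by (intro sum.mono_neutral_right) (auto simp: pade_exp_denom_nth_eq_0)
  \<comment> \<open>The quotient \<open>(2N-1-k)! / (m-k)!\<close> is \<open>?r!\<close> times a
    binomial coefficient with fixed lower index \<open>?r\<close>, and \<open>N \<le> m\<close>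
    gives \<open>?r < N\<close>.\<close>
  also have "\<dots> = (\<Sum>k\<le>N. fact ?r / fact (2 * N - 1) *
      ((-1) ^ k * of_nat (N choose k) * of_nat ((2 * N - 1 - k) choose ?r)))"
  proof (intro sum.cong refl)
    fix k assume "k \<in> {..N}"
    then have "?r \<le> 2 * N - 1 - k" "2 * N - 1 - k - ?r = m - k"
      using assms by auto
    then have "real ((2 * N - 1 - k) choose ?r) = fact (2 * N - 1 - k) / (fact ?r * fact (m - k))"
      by (simp add: binomial_fact)
    then show "fps_nth (pade_exp_denom N) k / fact (m - k) = fact ?r / fact (2 * N - 1) *
      ((-1) ^ k * of_nat (N choose k) * of_nat ((2 * N - 1 - k) choose ?r))"
      by (simp add: pade_exp_denom_def)
  qed
  also have "\<dots> = 0"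
    unfolding sum_distrib_left[symmetric]
    by (subst alternating_sum_binomial_choose_eq_0) (use assms in auto)
  finally show ?thesis .
qed

lemma pade_approximant_denom_exists:
  fixes f :: "real fps"
  assumes f: "f * (fps_exp 1 + 1) = 2 * fps_exp 1" and "0 < N"
  obtains Q :: "real fps" where
    "fps_nth Q 0 = 1" "fps_nth Q N = (-1) ^ N * fact N / fact (2 * N)"
    "\<And>k. N < k \<Longrightarrow> fps_nth Q k = 0"
    "\<And>m. N \<le> m \<Longrightarrow> m < 2 * N \<Longrightarrow> fps_nth (f * Q) m = 0"
proof
  let ?E = "fps_exp 1 :: real fps"
  define D where "D = pade_exp_denom N"
  \<comment> \<open>Cut off at \<open>2 * N\<close>, yet of degree below \<open>N\<close>: the
    coefficients in between vanish by the previous lemma.\<close>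
  define R where "R = fps_cutoff (2 * N) (?E * D)"
  define S where "S = fps_shift (2 * N) (?E * D)"
  define Q where "Q = fps_const (1 / 2) * (D + R)"
  have R_eq_0: "fps_nth R m = 0" if "N \<le> m" for m
    using that exp_mult_pade_exp_denom_nth_eq_0[of N m] by (auto simp: R_def D_def)
  have ED: "?E * D = R + fps_X ^ (2 * N) * S"
    unfolding R_def S_def by (subst fps_shift_cutoff[symmetric, of _ "2 * N"]) (simp add: mult.commute)
  have unit: "inverse (?E + 1) * ((?E + 1) * g) = g" for g
    by (simp add: inverse_mult_eq_1 flip: mult.assoc)
  have two: "2 * Q = D + R"
    by (simp add: Q_def numeral_fps_const flip: mult.assoc)
  have "(?E + 1) * (f * Q) = ?E * (2 * Q)"
    by (metis f mult.assoc mult.commute)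
  \<comment> \<open>Only \<open>?E * D\<close> is expanded; the remaining \<open>?E * R\<close>
    completes \<open>(?E + 1) * R\<close>. Dividing by the unit \<open>?E + 1\<close> keeps the
    error at order \<open>2 * N\<close>.\<close>
  also have "\<dots> = (?E + 1) * R + fps_X ^ (2 * N) * S"
    unfolding two distrib_left ED by (simp add: algebra_simps)
  finally have "inverse (?E + 1) * ((?E + 1) * (f * Q))
      = inverse (?E + 1) * ((?E + 1) * R + fps_X ^ (2 * N) * S)"
    by simp
  then have fQ: "f * Q = R + fps_X ^ (2 * N) * (inverse (?E + 1) * S)"
    unfolding distrib_left[of "inverse (?E + 1)"] unit by (simp only: mult.left_commute)
  show "fps_nth (f * Q) m = 0" if "N \<le> m" "m < 2 * N" for m
    unfolding fQ using that by (simp add: R_eq_0 fps_X_power_mult_nth)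
  show "fps_nth Q k = 0" if "N < k" for k
    using that by (simp add: Q_def D_def pade_exp_denom_nth_eq_0 R_eq_0)
  show "fps_nth Q 0 = 1"
    using \<open>0 < N\<close> by (simp add: Q_def R_def D_def pade_exp_denom_def)
  \<comment> \<open>At index \<open>N\<close> only \<open>D\<close> contributes to \<open>Q\<close>,
    so its top coefficient is halved.\<close>
  have "fact N = real N * fact (N - 1)" "fact (2 * N) = 2 * real N * fact (2 * N - 1)"
    using \<open>0 < N\<close> by (simp_all add: fact_reduce)
  moreover have "2 * N - 1 - N = N - 1"
    by simp
  ultimately show "fps_nth Q N = (-1) ^ N * fact N / fact (2 * N)"
    using \<open>0 < N\<close> by (simp add: Q_def D_def R_eq_0 pade_exp_denom_def)
qed

lemma hankel_det_shift:
  assumes rec: "\<And>i. i \<le> n \<Longrightarrow> a (i + Suc n) = (\<Sum>j\<le>n. c j * a (i + j))"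
  shows "hankel_det n (\<lambda>k. a (k + 1)) = (-1) ^ n * c 0 * hankel_det n a"
proof -
  let ?A = "mat (n + 1) (n + 1) (\<lambda>(i, j). a (i + j))"
  let ?B = "mat (n + 1) (n + 1) (\<lambda>(i, j). a (i + j + 1))"
  define K where "K = mat (n + 1) (n + 1) (\<lambda>(i, j). if j = n then c i else if i = j + 1 then 1 else 0)"
  have K: "K \<in> carrier_mat (n + 1) (n + 1)"
    by (simp add: K_def)
  have AK: "?A * K = ?B"
  proof (rule eq_matI)
    fix i j assume "i < dim_row ?B" "j < dim_col ?B"
    then have ij: "i \<le> n" "j \<le> n" by auto
    have "(?A * K) $$ (i, j) =
        (\<Sum>k\<le>n. a (i + k) * (if j = n then c k else if k = j + 1 then 1 else 0))"
      using ij by (simp add: K_def scalar_prod_def atLeast0LessThan lessThan_Suc_atMost)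
    also have "\<dots> = a (i + j + 1)"
    proof (cases "j = n")
      case True
      then show ?thesis using rec[OF ij(1)] by (simp add: mult.commute)
    next
      case False
      then show ?thesis using ij by (simp add: if_distrib cong: if_cong)
    qed
    finally show "(?A * K) $$ (i, j) = ?B $$ (i, j)"
      using ij by simp
  qed (simp_all add: K_def)
  \<comment> \<open>Row 0 of the companion matrix is zero except for \<open>c 0\<close> in column
    \<open>n\<close>, whose minor is the identity.\<close>
  have "det K = (\<Sum>j<n + 1. K $$ (0, j) * cofactor K 0 j)"
    by (rule laplace_expansion_row[OF K]) simp
  also have "\<dots> = (\<Sum>j\<le>n. if j = n then c 0 * cofactor K 0 n else 0)"
    by (intro sum.cong) (auto simp: K_def)
  also have "\<dots> = c 0 * cofactor K 0 n"
    by simp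
  also have "mat_delete K 0 n = 1\<^sub>m n"
    by (rule eq_matI) (auto simp: mat_delete_def K_def)
  then have "cofactor K 0 n = (-1) ^ n"
    by (simp add: cofactor_def)
  finally have "det K = c 0 * (-1) ^ n" .
  moreover have "det ?B = det ?A * det K"
    unfolding AK[symmetric] by (rule det_mult[OF _ K]) simp
  ultimately show ?thesis
    by (simp add: hankel_det_def)
qed

theorem proposition3p6:
  fixes n :: nat
  assumes "n \<ge> 1"
  shows "hankel_det n (\<lambda>k. euler_poly k 1 / fact k) =
    fact (2 * n + 2) / fact (n + 1) * hankel_det n (\<lambda>k. euler_poly (k + 1) 1 / fact (k + 1))"
proof -
  define a where "a = (\<lambda>k. euler_poly k 1 / fact k)"
  have "Abs_fps a * (fps_exp 1 + 1) = 2 * fps_exp 1"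
    using euler_poly_gen_fun[of 1] by (simp add: a_def)
  from pade_approximant_denom_exists[OF this zero_less_Suc[of n]] obtain Q where Q:
    "fps_nth Q 0 = 1" "fps_nth Q (Suc n) = (-1) ^ Suc n * fact (Suc n) / fact (2 * Suc n)"
    "\<And>k. Suc n < k \<Longrightarrow> fps_nth Q k = 0"
    "\<And>m. Suc n \<le> m \<Longrightarrow> m < 2 * Suc n \<Longrightarrow> fps_nth (Abs_fps a * Q) m = 0"
    by metis
  \<comment> \<open>Reversed, so that \<open>c 0\<close> comes from the top coefficient of
    \<open>Q\<close>; the sign comes from moving the term with \<open>fps_nth Q 0 = 1\<close> to the
    other side.\<close>
  define c where "c j = - fps_nth Q (Suc n - j)" for j
  have "a (i + Suc n) = (\<Sum>j\<le>n. c j * a (i + j))" if "i \<le> n" for i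
  proof -
    have "0 = fps_nth (Q * Abs_fps a) (i + Suc n)"
      using that Q(4)[of "i + Suc n"] by (simp add: mult.commute)
    also have "\<dots> = (\<Sum>k\<le>i + Suc n. fps_nth Q k * a (i + Suc n - k))"
      by (simp add: fps_mult_nth atLeast0AtMost)
    also have "\<dots> = (\<Sum>k\<le>Suc n. fps_nth Q k * a (i + Suc n - k))"
      by (intro sum.mono_neutral_right) (auto simp: Q(3))
    also have "\<dots> = (\<Sum>j\<le>Suc n. fps_nth Q (Suc n - j) * a (i + j))"
      by (rule sum.reindex_bij_witness[of _ "\<lambda>j. Suc n - j" "\<lambda>j. Suc n - j"]) auto
    also have "\<dots> = (\<Sum>j\<le>n. fps_nth Q (Suc n - j) * a (i + j)) + a (i + Suc n)"
      by (simp add: Q(1))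
    finally show ?thesis
      by (simp add: c_def sum_negf)
  qed
  then have "hankel_det n (\<lambda>k. a (k + 1)) = (-1) ^ n * c 0 * hankel_det n a"
    by (rule hankel_det_shift)
  \<comment> \<open>The signs \<open>(-1) ^ n\<close>, \<open>(-1) ^ Suc n\<close> and the minus in
    \<open>c\<close> cancel.\<close>
  moreover have "(-1) ^ n * c 0 = fact (n + 1) / fact (2 * n + 2)"
    by (simp add: c_def Q(2) flip: power_mult_distrib del: fact_Suc)
  ultimately show ?thesis
    by (simp add: a_def del: fact_Suc)
qed

end
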